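(* Let $x\in\mathrm{AD}_+^{\Omega}\cap\mathrm{OT}_+^{\Omega}$ (for $\gamma=2$). Then $\varphi^\tau(x)$ converges to a point in $\mathcal{M}_{23}^-\cup\mathcal{M}_{32}^+$ as $\tau\to-\infty$. In particular, the limits as $\tau\to-\infty$ of the eigenvalues of the expansion-normalized Weingarten map $K(\tau)$ exist, and if one of them is non-positive, then it is the limit of the eigenvalue whose eigenspace coincides with the direction orthogonal to the Abelian $G_2$ (i.e. the direction $e_1$).
   Context: Stiff fluid case $\gamma=2$. Consider the autonomous system for $(M,P,\theta,\Sigma_+,\Sigma_-)\in\mathbb{R}^5$ (expansion-normalized Einstein equations for Bianchi type VI$_{-1/9}$ with an orthogonal stiff fluid), with $'=d/d\tau$: $$M'=[q+2\Sigma_++2\sqrt3\cos(\theta)\Sigma_-]M,$$ $$P'=[-(2-q)-(3+\sin^2\theta)\Sigma_++\sqrt3\cos(\theta)\Sigma_-]P,$$ $$\theta'=-2\sqrt3\,\Sigma_-\sin\theta,$$ $$\Sigma_+'=-(2-q)\Sigma_+-2M^2+3P^2,$$ $$\Sigma_-'=-(2-q)\Sigma_--\sqrt3\cos(\theta)\big(2M^2+P^2-\tfrac23\sin^2(\theta)\Sigma_+^2\big),$$ where $q=2-2(1+\tfrac13\sin^2\theta)M^2$. Put $\Omega=1-(1+\tfrac13\sin^2\theta)(M^2+\Sigma_+^2)-P^2-\Sigma_-^2$; along solutions $\Omega'=-2(2-q)\Omega$. Phase space: $\mathrm{B}_+=\{(M,P,\theta,\Sigma_+,\Sigma_-)\in\mathbb{R}^5: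 M>0,\ P\ge0,\ \theta\in(0,\pi),\ \Omega\ge0\}$; $\mathrm{B}_+^{\Omega}=\mathrm{B}_+\cap\{\Omega>0\}$; orthogonally-transitive part $\mathrm{OT}_+^{\Omega}=\mathrm{B}_+^{\Omega}\cap\{P=0\}$. All are invariant under the (complete) flow $\varphi^\tau$ of the system. For every $x\in\mathrm{B}_+^{\Omega}$ the limit $\lim_{\tau\to-\infty}\varphi^\tau(x)$ exists and has the form $(0,0,\psi(x),s_+(x),s_-(x))$. Define $\mathrm{AD}_+^{\Omega}=\{x\in\mathrm{B}_+^{\Omega}:\sin(\psi(x))=0\text{ and } (s_+(x),s_-(x))\ne(0,0)\}$. Limit sets: $\mathcal{M}^-_{23}=\{(0,0,\pi,\Sigma_+,\Sigma_-):\Sigma_+^2+\Sigma_-^2<1,\ \Sigma_+-\sqrt3\Sigma_->-1,\ \Sigma_->0\}$, $\mathcal{M}^+_{32}=\{(0,0,0,\Sigma_+,\Sigma_-):\Sigma_+^2+\Sigma_-^2<1,\ \Sigma_++\sqrt3\Sigma_->-1,\ \Sigma_-<0\}$. The expansion-normalized Weingarten map is represented, in a canonical orthonormal frame $e_1,e_2,e_3$, by the symmetric $3\times3$ matrix $K=\Sigma+\tfrac13 I$ with $\Sigma_{11}=-\tfrac23\Sigma_+$, $\Sigma_{22}=\tfrac13(\Sigma_++\sqrt3\Sigma_-)$, $\Sigma_{33}=\tfrac13(\Sigma_+-\sqrt3\Sigma_-)$, $\Sigma_{23}=\tfrac13\Sigma_+\sin\theta$, $\Sigma_{31}=\tfrac1{\sqrt3}P\cos(\theta/2)$,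 $\Sigma_{12}=\tfrac1{\sqrt3}P\sin(\theta/2)$; $K(\tau)$ is this matrix evaluated at $\varphi^\tau(x)$. In this frame $e_2,e_3$ are tangent to the orbits of the two-dimensional Abelian subgroup $G_2$ of the isometry group and $e_1$ is the spatial direction orthogonal to it; when $P=0$, $e_1$ is an eigenvector of $K(\tau)$, with eigenvalue $K_{11}=\tfrac13(1-2\Sigma_+)$. *)

theory Defs
  imports "HOL-Analysis.Analysis"
begin

text \<open>Points are tuples \<open>(M, P, \<theta>, \<Sigma>\<^sub>+, \<Sigma>\<^sub>-)\<close>.\<close>

type_synonym state = "real \<times> real \<times> real \<times> real \<times> real"

definition decel :: "real \<Rightarrow> real \<Rightarrow> real" where
  "decel M \<theta> = 2 - 2 * (1 + (sin \<theta>)\<^sup>2 / 3) * M\<^sup>2"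

fun vector_field :: "state \<Rightarrow> state" where
  "vector_field (M, P, \<theta>, Sp, Sm) =
    (let q = decel M \<theta> in
     ((q + 2 * Sp + 2 * sqrt 3 * cos \<theta> * Sm) * M,
      (- (2 - q) - (3 + (sin \<theta>)\<^sup>2) * Sp + sqrt 3 * cos \<theta> * Sm) * P,
      - 2 * sqrt 3 * Sm * sin \<theta>,
      - (2 - q) * Sp - 2 * M\<^sup>2 + 3 * P\<^sup>2,
      - (2 - q) * Sm - sqrt 3 * cos \<theta> * (2 * M\<^sup>2 + P\<^sup>2 - 2 / 3 * (sin \<theta>)\<^sup>2 * Sp\<^sup>2)))"

fun Omega :: "state \<Rightarrow> real" where
  "Omega (M, P, \<theta>, Sp, Sm) =
    1 - (1 + (sin \<theta>)\<^sup>2 / 3) * (M\<^sup>2 + Sp\<^sup>2) - P\<^sup>2 - Sm\<^sup>2"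

definition B_plus :: "state set" where
  "B_plus = {(M, P, \<theta>, Sp, Sm). M > 0 \<and> P \<ge> 0 \<and> 0 < \<theta> \<and> \<theta> < pi \<and> Omega (M, P, \<theta>, Sp, Sm) \<ge> 0}"

definition B_plus_Omega :: "state set" where
  "B_plus_Omega = B_plus \<inter> {x. Omega x > 0}"

definition OT_plus_Omega :: "state set" where
  "OT_plus_Omega = B_plus_Omega \<inter> {(M, P, \<theta>, Sp, Sm). P = 0}"

text \<open>\<open>\<phi> \<tau> x\<close> is the value at time \<open>\<tau>\<close> of the (complete) solution starting at \<open>x\<close>.
  As the vector field is smooth, this determines \<open>\<phi>\<close> on \<open>B_plus\<close>; invariance of
  the phase space and the group property are consequences and are not part of the definition.\<close>

definition is_flow :: "(real \<Rightarrow> state \<Rightarrow> state) \<Rightarrow> bool" where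
  "is_flow \<phi> \<longleftrightarrow> (\<forall>x\<in>B_plus. \<phi> 0 x = x \<and>
     (\<forall>\<tau>. ((\<lambda>t. \<phi> t x) has_vector_derivative vector_field (\<phi> \<tau> x)) (at \<tau>)))"

definition AD_plus_Omega :: "(real \<Rightarrow> state \<Rightarrow> state) \<Rightarrow> state set" where
  "AD_plus_Omega \<phi> = {x \<in> B_plus_Omega. \<exists>\<psi> sp sm.
     ((\<lambda>\<tau>. \<phi> \<tau> x) \<longlongrightarrow> (0, 0, \<psi>, sp, sm)) at_bot \<and> sin \<psi> = 0 \<and> (sp, sm) \<noteq> (0, 0)}"

definition M23_minus :: "state set" where
  "M23_minus = {(0, 0, pi, Sp, Sm) | Sp Sm.
     Sp\<^sup>2 + Sm\<^sup>2 < 1 \<and> Sp - sqrt 3 * Sm > -1 \<and> Sm > 0}"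

definition M32_plus :: "state set" where
  "M32_plus = {(0, 0, 0, Sp, Sm) | Sp Sm.
     Sp\<^sup>2 + Sm\<^sup>2 < 1 \<and> Sp + sqrt 3 * Sm > -1 \<and> Sm < 0}"

fun shear :: "state \<Rightarrow> real^3^3" where
  "shear (M, P, \<theta>, Sp, Sm) =
    (let S11 = - 2 / 3 * Sp;
         S22 = (Sp + sqrt 3 * Sm) / 3;
         S33 = (Sp - sqrt 3 * Sm) / 3;
         S23 = Sp * sin \<theta> / 3;
         S31 = P * cos (\<theta> / 2) / sqrt 3;
         S12 = P * sin (\<theta> / 2) / sqrt 3
     in vector [vector [S11, S12, S31],
                vector [S12, S22, S23],
                vector [S31, S23, S33]])"

definition weingarten :: "state \<Rightarrow> real^3^3" where
  "weingarten x = shear x + (1 / 3) *\<^sub>R mat 1"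

text \<open>\<open>a \<le> b \<le> c\<close> are the eigenvalues of \<open>A\<close>, repeated according to their multiplicity as
  roots of the characteristic polynomial. This determines \<open>a\<close>, \<open>b\<close> and \<open>c\<close>.\<close>

definition ordered_eigenvalues :: "real^3^3 \<Rightarrow> real \<Rightarrow> real \<Rightarrow> real \<Rightarrow> bool" where
  "ordered_eigenvalues A a b c \<longleftrightarrow> a \<le> b \<and> b \<le> c \<and>
     (\<forall>t. det (t *\<^sub>R mat 1 - A) = (t - a) * (t - b) * (t - c))"

definition eigenspace :: "real^3^3 \<Rightarrow> real \<Rightarrow> (real^3) set" where
  "eigenspace A k = {v. A *v v = k *\<^sub>R v}"

end

theory Submission
  imports Defs
begin

text \<open>With \<open>P = 0\<close> the flow satisfies linear equations for \<open>M\<close>, \<open>sin \<theta>\<close> and \<open>\<Omega>\<close>, so these stay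
  positive, and \<open>\<Omega>\<close> increases towards the past. By the reflection
  \<open>(\<theta>, \<Sigma>\<^sub>-) \<mapsto> (\<pi> - \<theta>, - \<Sigma>\<^sub>-)\<close> one may assume \<open>\<theta> \<longlonglongrightarrow> 0\<close>. As \<open>M\<close> and \<open>sin \<theta>\<close> tend to \<open>0\<close>, their
  logarithmic derivatives have non-negative limits \<open>2 (1 + s\<^sub>+ + \<surd>3 s\<^sub>-)\<close> and \<open>- 2 \<surd>3 s\<^sub>-\<close>. If one
  of these limits vanishes, the other one is positive; comparing the decay of \<open>M\<close> and
  \<open>sin \<theta>\<close> then gives the degenerate logarithmic derivative a sign that contradicts the
  convergence to \<open>0\<close>. The resulting strict inequalities make the limits of the two
  eigenvalues of the lower block of \<open>K\<close> positive.\<close>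

section \<open>Scalar linear equations near minus infinity\<close>

text \<open>Integrating factor: \<open>E t = exp (G t - G 0)\<close> with an antiderivative
  \<open>G\<close> of \<open>g\<close> on the whole line. Hence both a positive sign and a zero of
  \<open>f\<close> at time 0 persist for all times.\<close>

lemma linear_ode_solution:
  fixes f g :: "real \<Rightarrow> real"
  assumes f: "\<And>t. (f has_real_derivative g t * f t) (at t)"
    and g: "\<And>t. isCont g t"
  obtains E where "\<And>t. E t > 0" "\<And>t. f t = f 0 * E t"
proof -
  obtain G where G: "\<And>t. (G has_real_derivative g t) (at t)"
    using einterval_antiderivative[of "-\<infinity>" "\<infinity>" g] g
    by (auto simp: has_real_derivative_iff_has_vector_derivative)
  have "((\<lambda>t. f t * exp (- G t)) has_real_derivative 0) (at t)" for t
    by (auto intro!: derivative_eq_intros f G)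
  then have "f t * exp (- G t) = f 0 * exp (- G 0)" for t
    using DERIV_isconst_all by blast
  then have "f t = f 0 * exp (G t - G 0)" for t
    by (simp add: exp_diff exp_minus field_simps)
  from that[OF _ this] show thesis
    by simp
qed

lemma linear_ode_pos:
  fixes f g :: "real \<Rightarrow> real"
  assumes "\<And>t. (f has_real_derivative g t * f t) (at t)" "\<And>t. isCont g t" "f 0 > 0"
  shows "f t > 0"
  using linear_ode_solution[OF assms(1,2)] assms(3) by (metis mult_pos_pos)

text \<open>Near minus infinity \<open>f\<close> is nondecreasing, so its limit there is approached
  from above.\<close>

lemma at_bot_limit_le:
  fixes f f' :: "real \<Rightarrow> real"
  assumes f: "\<And>t. (f has_real_derivative f' t) (at t)"
    and lim: "(f \<longlongrightarrow> l) at_bot"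
    and f': "\<forall>\<^sub>F t in at_bot. f' t \<ge> 0"
  shows "\<forall>\<^sub>F t in at_bot. l \<le> f t"
proof -
  obtain T where T: "\<And>t. t \<le> T \<Longrightarrow> f' t \<ge> 0"
    using f' by (auto simp: eventually_at_bot_linorder)
  have mono: "f s \<le> f t" if "s \<le> t" "t \<le> T" for s t
    using that by (intro DERIV_nonneg_imp_nondecreasing[of s t f]) (auto intro!: T exI f)
  have "l \<le> f t" if "t \<le> T" for t
    by (rule tendsto_upperbound[OF lim])
      (auto intro!: eventually_at_bot_linorderI[of t] mono that)
  then show ?thesis
    by (auto simp: eventually_at_bot_linorder)
qed

lemma at_bot_limit_ge:
  fixes f f' :: "real \<Rightarrow> real"
  assumes f: "\<And>t. (f has_real_derivative f' t) (at t)"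
    and lim: "(f \<longlongrightarrow> l) at_bot"
    and f': "\<forall>\<^sub>F t in at_bot. f' t \<le> 0"
  shows "\<forall>\<^sub>F t in at_bot. f t \<le> l"
  using at_bot_limit_le[of "\<lambda>t. - f t" "\<lambda>t. - f' t" "- l"] f lim f'
  by (auto intro!: derivative_intros tendsto_intros)

text \<open>Otherwise the positive \<open>f\<close> would be nonincreasing near minus infinity and
  so bounded above by its limit 0. Only the eventual sign of \<open>g\<close> enters, which covers
  rates that tend to 0.\<close>

lemma log_deriv_not_nonpos:
  fixes f g :: "real \<Rightarrow> real"
  assumes f: "\<And>t. (f has_real_derivative g t * f t) (at t)"
    and pos: "\<And>t. f t > 0" and lim: "(f \<longlongrightarrow> 0) at_bot"
  shows "\<not> (\<forall>\<^sub>F t in at_bot. g t \<le> 0)"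
proof
  assume "\<forall>\<^sub>F t in at_bot. g t \<le> 0"
  then have "\<forall>\<^sub>F t in at_bot. g t * f t \<le> 0"
    by eventually_elim (use pos in \<open>simp add: mult_le_0_iff less_imp_le\<close>)
  from at_bot_limit_ge[OF f lim this] have "\<forall>\<^sub>F t in at_bot. f t \<le> 0" .
  then show False
    using pos by (force simp: eventually_at_bot_linorder not_le[symmetric])
qed

lemma log_deriv_limit_nonneg:
  fixes f g :: "real \<Rightarrow> real"
  assumes "\<And>t. (f has_real_derivative g t * f t) (at t)"
    and "\<And>t. f t > 0" and "(f \<longlongrightarrow> 0) at_bot" and g: "(g \<longlongrightarrow> l) at_bot"
  shows "l \<ge> 0"
proof (rule ccontr)
  assume "\<not> l \<ge> 0"
  then have "\<forall>\<^sub>F t in at_bot. g t < 0"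
    using g by (auto simp: order_tendsto_iff)
  then have "\<forall>\<^sub>F t in at_bot. g t \<le> 0"
    by eventually_elim simp
  with log_deriv_not_nonpos[OF assms(1-3)] show False ..
qed

text \<open>Comparison with an exponential: once \<open>g t > l / 2\<close>, the quotient
  \<open>h\<close> of \<open>f\<close> by \<open>exp (l / 2 * t)\<close> is nondecreasing, which
  bounds \<open>f\<close> towards the past.\<close>

lemma log_deriv_limit_pos_imp_tendsto_0:
  fixes f g :: "real \<Rightarrow> real"
  assumes f: "\<And>t. (f has_real_derivative g t * f t) (at t)"
    and pos: "\<And>t. f t > 0" and g: "(g \<longlongrightarrow> l) at_bot" and l: "l > 0"
  shows "(f \<longlongrightarrow> 0) at_bot"
proof -
  have "\<forall>\<^sub>F t in at_bot. g t > l / 2"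
    using g by (rule order_tendstoD) (use l in simp)
  then obtain T where T: "\<And>t. t \<le> T \<Longrightarrow> g t > l / 2"
    by (auto simp: eventually_at_bot_linorder)
  define h where "h = (\<lambda>t. f t * exp (- (l / 2 * t)))"
  have h': "(h has_real_derivative (g t - l / 2) * h t) (at t)" for t
    unfolding h_def by (auto intro!: derivative_eq_intros f simp: algebra_simps)
  have "(g t - l / 2) * h t \<ge> 0" if "t \<le> T" for t
    using T[OF that] pos[of t] by (simp add: h_def)
  with h' have "h t \<le> h T" if "t \<le> T" for t
    using that by (intro DERIV_nonneg_imp_nondecreasing[of t T h]) blast+
  then have "f t \<le> h T * exp (l / 2 * t)" if "t \<le> T" for t
    using that by (fastforce simp: h_def exp_minus field_simps)
  then have le: "\<forall>\<^sub>F t in at_bot. f t \<le> h T * exp (l / 2 * t)"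
    by (auto simp: eventually_at_bot_linorder)
  have lim: "((\<lambda>t. h T * exp (l / 2 * t)) \<longlongrightarrow> 0) at_bot"
    using l by (intro tendsto_mult_right_zero filterlim_compose[OF exp_at_bot]
        filterlim_tendsto_pos_mult_at_bot[OF tendsto_const _ filterlim_ident]) auto
  show ?thesis
    by (rule tendsto_sandwich[OF _ le tendsto_const lim]) (use pos in \<open>simp add: less_imp_le\<close>)
qed

section \<open>Orthogonally transitive solutions\<close>

text \<open>The variables \<open>u\<close>, \<open>c\<close>, \<open>p\<close>, \<open>s\<close> stand for \<open>sin \<theta>\<close>, \<open>cos \<theta>\<close>, \<open>\<Sigma>\<^sub>+\<close>, \<open>\<Sigma>\<^sub>-\<close>, and \<open>d\<close> for
  \<open>2 - q\<close>. Eliminating \<open>\<theta>\<close> turns the reflection into the sign change of \<open>c\<close> and \<open>s\<close>.\<close>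

locale ot_solution =
  fixes M u c p s d :: "real \<Rightarrow> real" and p0 s0 :: real
  assumes d: "\<And>t. d t = 2 * (1 + (u t)\<^sup>2 / 3) * (M t)\<^sup>2"
    and M': "\<And>t. (M has_real_derivative (2 - d t + 2 * p t + 2 * sqrt 3 * c t * s t) * M t) (at t)"
    and u': "\<And>t. (u has_real_derivative (- 2 * sqrt 3 * s t * c t) * u t) (at t)"
    and c': "\<And>t. (c has_real_derivative 2 * sqrt 3 * s t * (u t)\<^sup>2) (at t)"
    and p': "\<And>t. (p has_real_derivative - d t * p t - 2 * (M t)\<^sup>2) (at t)"
    and s': "\<And>t. (s has_real_derivative
      - d t * s t - sqrt 3 * c t * (2 * (M t)\<^sup>2 - 2 / 3 * (u t)\<^sup>2 * (p t)\<^sup>2)) (at t)"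
    and M_init: "M 0 > 0" and u_init: "u 0 > 0"
    and W_init: "1 - (1 + (u 0)\<^sup>2 / 3) * ((M 0)\<^sup>2 + (p 0)\<^sup>2) - (s 0)\<^sup>2 > 0"
    and M_lim: "(M \<longlongrightarrow> 0) at_bot" and u_lim: "(u \<longlongrightarrow> 0) at_bot"
    and c_lim: "(c \<longlongrightarrow> 1) at_bot"
    and p_lim: "(p \<longlongrightarrow> p0) at_bot" and s_lim: "(s \<longlongrightarrow> s0) at_bot"
    and nonzero: "(p0, s0) \<noteq> (0, 0)"
begin

lemma cont: "isCont M t" "isCont u t" "isCont c t" "isCont p t" "isCont s t" "isCont d t"
proof -
  show *: "isCont M t" "isCont u t" "isCont c t" "isCont p t" "isCont s t"
    using M' u' c' p' s' by (blast intro: DERIV_isCont)+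
  show "isCont d t"
    unfolding d[abs_def] by (intro continuous_intros *) auto
qed

lemma M_pos: "M t > 0"
  by (rule linear_ode_pos[OF M' _ M_init]) (intro continuous_intros cont)

lemma u_pos: "u t > 0"
  by (rule linear_ode_pos[OF u' _ u_init]) (intro continuous_intros cont)

text \<open>This is \<open>Omega\<close> at \<open>P = 0\<close> in the variables of the
  locale.\<close>

definition W :: "real \<Rightarrow> real" where
  "W t = 1 - (1 + (u t)\<^sup>2 / 3) * ((M t)\<^sup>2 + (p t)\<^sup>2) - (s t)\<^sup>2"

lemma W': "(W has_real_derivative (- 2 * d t) * W t) (at t)"
  unfolding W_def[abs_def] using M' u' p' s'
  by (auto intro!: derivative_eq_intros simp: d) (simp add: field_simps power2_eq_square)

lemma W_pos: "W t > 0"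
  by (rule linear_ode_pos[OF W']) (use W_init in \<open>auto intro!: continuous_intros cont simp: W_def\<close>)

lemma d_nonneg: "d t \<ge> 0"
  by (simp add: d)

lemma d_lim: "(d \<longlongrightarrow> 0) at_bot"
  unfolding d[abs_def] by (auto intro!: tendsto_eq_intros M_lim u_lim)

text \<open>The strict inequality comes from monotonicity: \<open>W\<close> grows towards the past,
  so its limit is at least \<open>W 0 > 0\<close>.\<close>

lemma limit_in_disc: "p0\<^sup>2 + s0\<^sup>2 < 1"
proof -
  have "(W \<longlongrightarrow> 1 - p0\<^sup>2 - s0\<^sup>2) at_bot"
    unfolding W_def[abs_def] by (auto intro!: tendsto_eq_intros M_lim u_lim p_lim s_lim)
  moreover have "\<forall>\<^sub>F t in at_bot. W 0 \<le> W t"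
  proof (rule eventually_at_bot_linorderI)
    fix t :: real assume "t \<le> 0"
    then show "W 0 \<le> W t"
      using W_pos d_nonneg
      by (intro DERIV_nonpos_imp_nonincreasing[of t 0 W])
        (auto intro!: exI W' simp: mult_nonneg_nonneg less_imp_le)
  qed
  ultimately have "W 0 \<le> 1 - p0\<^sup>2 - s0\<^sup>2"
    by (intro tendsto_lowerbound) auto
  with W_pos[of 0] show ?thesis
    by simp
qed

lemma limit_M_rate: "1 + p0 + sqrt 3 * s0 \<ge> 0"
proof -
  have "((\<lambda>t. 2 - d t + 2 * p t + 2 * sqrt 3 * c t * s t) \<longlongrightarrow> 2 * (1 + p0 + sqrt 3 * s0)) at_bot"
    by (auto intro!: tendsto_eq_intros d_lim p_lim c_lim s_lim)
  from log_deriv_limit_nonneg[OF M' M_pos M_lim this] show ?thesis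
    by simp
qed

lemma limit_u_rate: "s0 \<le> 0"
proof -
  have "((\<lambda>t. - 2 * sqrt 3 * s t * c t) \<longlongrightarrow> - 2 * sqrt 3 * s0) at_bot"
    by (auto intro!: tendsto_eq_intros c_lim s_lim)
  from log_deriv_limit_nonneg[OF u' u_pos u_lim this] show ?thesis
    by (simp add: mult_le_0_iff)
qed

text \<open>For \<open>s0 = 0\<close> the rate of \<open>u\<close> tends to 0 and that of
  \<open>M\<close> to a positive number, so \<open>M\<close> is negligible against \<open>u\<close>.
  The part with \<open>(u t)\<^sup>2 * (p t)\<^sup>2\<close> then dominates the source term of
  \<open>s\<close> and makes it non-negative. As \<open>s\<close> tends to 0, this forces
  \<open>s t \<ge> 0\<close> near minus infinity, so \<open>u\<close> cannot decay to 0.\<close>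

lemma limit_s_nonzero: "s0 \<noteq> 0"
proof
  assume s0: "s0 = 0"
  \<comment> \<open>The first fact fixes the sign of the source term of \<open>s\<close>, the second
    makes the limiting rate \<open>2 + 2 * p0\<close> of \<open>M / u\<close> positive.\<close>
  then have p0: "p0 \<noteq> 0" "p0 > -1"
    using nonzero limit_in_disc by (auto simp: power2_less_1_iff abs_less_iff)
  have M_u': "((\<lambda>t. M t / u t) has_real_derivative
      (2 - d t + 2 * p t + 4 * sqrt 3 * c t * s t) * (M t / u t)) (at t)" for t
    using M'[of t] u'[of t] u_pos[of t]
    by (auto intro!: derivative_eq_intros) (simp add: field_simps)
  have rate: "((\<lambda>t. 2 - d t + 2 * p t + 4 * sqrt 3 * c t * s t) \<longlongrightarrow> 2 + 2 * p0) at_bot"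
    by (auto intro!: tendsto_eq_intros d_lim p_lim c_lim s_lim simp: s0)
  have M_u: "((\<lambda>t. M t / u t) \<longlongrightarrow> 0) at_bot"
    by (rule log_deriv_limit_pos_imp_tendsto_0[OF M_u' _ rate]) (use M_pos u_pos p0 in auto)
  have "((\<lambda>t. 2 * (M t / u t)\<^sup>2 - 2 / 3 * (p t)\<^sup>2) \<longlongrightarrow> 2 * 0\<^sup>2 - 2 / 3 * p0\<^sup>2) at_bot"
    by (intro tendsto_diff tendsto_mult tendsto_power tendsto_const M_u p_lim)
  moreover have "2 * 0\<^sup>2 - 2 / 3 * p0\<^sup>2 < 0"
    using p0 by simp
  ultimately have "\<forall>\<^sub>F t in at_bot. 2 * (M t / u t)\<^sup>2 - 2 / 3 * (p t)\<^sup>2 < 0"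
    by (rule order_tendstoD)
  moreover have c_pos: "\<forall>\<^sub>F t in at_bot. c t > 0"
    using c_lim by (rule order_tendstoD) simp
  ultimately have nonneg: "\<forall>\<^sub>F t in at_bot.
      - sqrt 3 * c t * (2 * (M t)\<^sup>2 - 2 / 3 * (u t)\<^sup>2 * (p t)\<^sup>2) / sqrt (W t) \<ge> 0"
  proof eventually_elim
    case (elim t)
    have "2 * (M t)\<^sup>2 - 2 / 3 * (u t)\<^sup>2 * (p t)\<^sup>2
        = (u t)\<^sup>2 * (2 * (M t / u t)\<^sup>2 - 2 / 3 * (p t)\<^sup>2)"
      using u_pos[of t] by (simp add: field_simps)
    also have "\<dots> \<le> 0"
      using elim(1) by (simp add: mult_le_0_iff)
    finally have "(2 * (M t)\<^sup>2 - 2 / 3 * (u t)\<^sup>2 * (p t)\<^sup>2) \<le> 0" .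
    then have "(sqrt 3 * c t) * (2 * (M t)\<^sup>2 - 2 / 3 * (u t)\<^sup>2 * (p t)\<^sup>2) \<le> 0"
      using elim(2) by (intro mult_nonneg_nonpos) auto
    then show ?case
      using W_pos[of t] by (simp add: divide_le_0_iff)
  qed
  txt \<open>Division by \<open>\<surd>W\<close> removes the damping term \<open>- d s\<close> from the equation of \<open>s\<close>.\<close>
  have deriv: "((\<lambda>t. s t / sqrt (W t)) has_real_derivative
      - sqrt 3 * c t * (2 * (M t)\<^sup>2 - 2 / 3 * (u t)\<^sup>2 * (p t)\<^sup>2) / sqrt (W t)) (at t)" for t
  proof -
    have sqrt_W': "((\<lambda>t. sqrt (W t)) has_real_derivative - d t * sqrt (W t)) (at t)"
      using W'[of t] W_pos[of t]
      by (auto intro!: derivative_eq_intros simp: real_sqrt_divide field_simps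
          simp flip: power2_eq_square)
    show ?thesis
      by (rule DERIV_cong[OF DERIV_divide[OF s' sqrt_W']])
        (use W_pos[of t] in \<open>simp_all add: field_simps\<close>)
  qed
  have lim: "((\<lambda>t. s t / sqrt (W t)) \<longlongrightarrow> 0) at_bot"
  proof -
    have "(W \<longlongrightarrow> 1 - p0\<^sup>2) at_bot"
      unfolding W_def[abs_def]
      by (auto intro!: tendsto_eq_intros M_lim u_lim p_lim s_lim simp: s0)
    then show ?thesis
      using limit_in_disc by (auto intro!: tendsto_eq_intros s_lim simp: s0)
  qed
  from at_bot_limit_le[OF deriv lim nonneg] have "\<forall>\<^sub>F t in at_bot. - 2 * sqrt 3 * s t * c t \<le> 0"
    using c_pos
  proof eventually_elim
    case (elim t)
    then have "s t \<ge> 0"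
      using W_pos[of t] by (simp add: zero_le_divide_iff)
    with elim(2) show ?case
      by simp
  qed
  with log_deriv_not_nonpos[OF u' u_pos u_lim] show False ..
qed

text \<open>In the case of equality the rate of \<open>M\<close> tends to 0 and that of
  \<open>u\<close> to a positive number, so now \<open>u\<close> is negligible against
  \<open>M\<close>. The rate of \<open>M\<close> is then shown to be non-positive near minus
  infinity, which is incompatible with \<open>M\<close> tending to 0.\<close>

lemma limit_M_rate_nonzero: "1 + p0 + sqrt 3 * s0 \<noteq> 0"
proof
  assume eq: "1 + p0 + sqrt 3 * s0 = 0"
  have s0: "s0 < 0"
    using limit_u_rate limit_s_nonzero by simp
  have u_M': "((\<lambda>t. u t / M t) has_real_derivative
      (- (2 - d t + 2 * p t + 4 * sqrt 3 * c t * s t)) * (u t / M t)) (at t)" for t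
    using M'[of t] u'[of t] M_pos[of t]
    by (auto intro!: derivative_eq_intros) (simp add: field_simps)
  have rate: "((\<lambda>t. - (2 - d t + 2 * p t + 4 * sqrt 3 * c t * s t))
      \<longlongrightarrow> - (2 * (1 + p0 + sqrt 3 * s0) + 2 * sqrt 3 * s0)) at_bot"
    by (auto intro!: tendsto_eq_intros d_lim p_lim c_lim s_lim)
  have u_M: "((\<lambda>t. u t / M t) \<longlongrightarrow> 0) at_bot"
    by (rule log_deriv_limit_pos_imp_tendsto_0[OF u_M' _ rate])
      (use M_pos u_pos eq s0 in \<open>auto simp: mult_neg_pos\<close>)
  define r where "r = (\<lambda>t. u t / M t)"
  have r_lim: "(r \<longlongrightarrow> 0) at_bot"
    using u_M by (simp add: r_def)
  \<comment> \<open>The rate of \<open>M\<close> is \<open>2 * A t - d t\<close>, so an upper bound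
    0 for \<open>A\<close> suffices.\<close>
  define A where "A = (\<lambda>t. 1 + p t + sqrt 3 * c t * s t)"
  \<comment> \<open>This is the derivative of \<open>A\<close> divided by
    \<open>(M t)\<^sup>2\<close>: the damping terms combine to \<open>d t * (1 - A t)\<close>, and
    each \<open>(u t)\<^sup>2\<close> of the remaining terms becomes
    \<open>(r t)\<^sup>2\<close>.\<close>
  define B where "B = (\<lambda>t. 2 * (1 + (u t)\<^sup>2 / 3) * (1 - A t) - 2 - 6 * (c t)\<^sup>2
    + (2 * (c t)\<^sup>2 * (p t)\<^sup>2 + 6 * (s t)\<^sup>2) * (r t)\<^sup>2)"
  have A_lim: "(A \<longlongrightarrow> 0) at_bot"
    unfolding A_def by (auto intro!: tendsto_eq_intros p_lim c_lim s_lim simp: eq)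
  have A': "(A has_real_derivative (M t)\<^sup>2 * B t) (at t)" for t
  proof -
    have 3: "sqrt 3 * (sqrt 3 * z) = 3 * z" for z
      by (simp flip: mult.assoc)
    have "(M t)\<^sup>2 * B t = 2 * (1 + (u t)\<^sup>2 / 3) * (M t)\<^sup>2 * (1 - A t) - 2 * (M t)\<^sup>2
        - 6 * (c t)\<^sup>2 * (M t)\<^sup>2 + (2 * (c t)\<^sup>2 * (p t)\<^sup>2 + 6 * (s t)\<^sup>2) * (u t)\<^sup>2"
      using M_pos[of t] by (simp add: B_def r_def field_simps)
    with p'[of t] c'[of t] s'[of t] show ?thesis
      unfolding A_def
      by (auto intro!: derivative_eq_intros simp: d)
        (simp add: field_simps power2_eq_square 3)
  qed
  have "(B \<longlongrightarrow> - 6) at_bot"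
    unfolding B_def by (auto intro!: tendsto_eq_intros A_lim u_lim c_lim p_lim s_lim r_lim)
  then have "\<forall>\<^sub>F t in at_bot. B t < 0"
    by (rule order_tendstoD) simp
  then have "\<forall>\<^sub>F t in at_bot. (M t)\<^sup>2 * B t \<le> 0"
    by eventually_elim (simp add: mult_le_0_iff)
  from at_bot_limit_ge[OF A' A_lim this]
  have "\<forall>\<^sub>F t in at_bot. 2 - d t + 2 * p t + 2 * sqrt 3 * c t * s t \<le> 0"
  proof eventually_elim
    case (elim t)
    then show ?case
      using d_nonneg[of t] by (simp add: A_def)
  qed
  with log_deriv_not_nonpos[OF M' M_pos M_lim] show False ..
qed

lemma limit_location: "p0\<^sup>2 + s0\<^sup>2 < 1" "p0 + sqrt 3 * s0 > -1" "s0 < 0"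
  using limit_in_disc limit_M_rate limit_M_rate_nonzero limit_u_rate limit_s_nonzero by auto

end

section \<open>Eigenvalues of the Weingarten map\<close>

lemma weingarten_OT:
  "weingarten (M, 0, \<theta>, Sp, Sm) = vector [vector [(1 - 2 * Sp) / 3, 0, 0],
    vector [0, (1 + Sp + sqrt 3 * Sm) / 3, Sp * sin \<theta> / 3],
    vector [0, Sp * sin \<theta> / 3, (1 + Sp - sqrt 3 * Sm) / 3]]"
  by (simp add: weingarten_def Let_def vec_eq_iff forall_3 mat_def field_simps)

lemma det_block:
  fixes a b c d :: real
  shows "det (t *\<^sub>R mat 1 - vector [vector [a, 0, 0], vector [0, b, c], vector [0, c, d]] :: real^3^3) =
    (t - a) * ((t - b) * (t - d) - c\<^sup>2)"
  by (simp add: det_3 mat_def) (simp add: algebra_simps power2_eq_square)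

text \<open>At \<open>P = 0\<close> the lower block of the Weingarten matrix has the eigenvalues
  \<open>(1 + Sp - r) / 3\<close> and \<open>(1 + Sp + r) / 3\<close>, where \<open>r\<close> is
  this number.\<close>

definition block_radius :: "state \<Rightarrow> real" where
  "block_radius = (\<lambda>(M, P, \<theta>, Sp, Sm). sqrt (3 * Sm\<^sup>2 + (Sp * sin \<theta>)\<^sup>2))"

lemma det_weingarten_OT:
  fixes M \<theta> Sp Sm :: real
  defines "r \<equiv> block_radius (M, 0, \<theta>, Sp, Sm)"
  shows "det (t *\<^sub>R mat 1 - weingarten (M, 0, \<theta>, Sp, Sm)) =
    (t - (1 - 2 * Sp) / 3) * (t - (1 + Sp - r) / 3) * (t - (1 + Sp + r) / 3)"
proof -
  have r: "r\<^sup>2 = 3 * Sm\<^sup>2 + (Sp * sin \<theta>)\<^sup>2"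
    by (simp add: r_def block_radius_def)
  have "det (t *\<^sub>R mat 1 - weingarten (M, 0, \<theta>, Sp, Sm)) = (t - (1 - 2 * Sp) / 3) *
      ((t - (1 + Sp + sqrt 3 * Sm) / 3) * (t - (1 + Sp - sqrt 3 * Sm) / 3)
        - (Sp * sin \<theta> / 3)\<^sup>2)"
    by (simp only: weingarten_OT det_block)
  also have "(t - (1 + Sp + sqrt 3 * Sm) / 3) * (t - (1 + Sp - sqrt 3 * Sm) / 3)
      - (Sp * sin \<theta> / 3)\<^sup>2 = (t - (1 + Sp) / 3)\<^sup>2 - (3 * Sm\<^sup>2 + (Sp * sin \<theta>)\<^sup>2) / 9"
  proof -
    have "sqrt 3 * (sqrt 3 * z) = 3 * z" for z
      by (simp flip: mult.assoc)
    then show ?thesis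
      by (simp add: field_simps power2_eq_square)
  qed
  also have "\<dots> = (t - (1 + Sp - r) / 3) * (t - (1 + Sp + r) / 3)"
    unfolding r[symmetric] by (simp add: field_simps power2_eq_square)
  finally show ?thesis
    by (simp add: mult.assoc)
qed

text \<open>Insertion of \<open>a\<close> into the pair \<open>b \<le> c\<close>. Since
  \<open>min\<close> and \<open>max\<close> are continuous, limits of the sorted eigenvalues follow
  even if the order of \<open>a\<close>, \<open>b\<close>, \<open>c\<close> changes with
  time.\<close>

lemma ordered_eigenvalues_sort:
  assumes "\<And>t. det (t *\<^sub>R mat 1 - A) = (t - a) * (t - b) * (t - c)" "b \<le> c"
  shows "ordered_eigenvalues A (min a b) (max b (min a c)) (max a c)"
  using assms unfolding ordered_eigenvalues_def by (auto simp: min_def max_def)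

text \<open>The eigenvalue of the direction \<open>axis 1 1\<close> lies below both eigenvalues of
  the lower block, so subtracting it leaves that block invertible and the eigenspace has no
  component there.\<close>

lemma eigenspace_weingarten_OT:
  assumes "(1 - 2 * Sp) / 3 < (1 + Sp - block_radius (M, 0, \<theta>, Sp, Sm)) / 3"
  shows "eigenspace (weingarten (M, 0, \<theta>, Sp, Sm)) ((1 - 2 * Sp) / 3) = span {axis 1 1}"
proof -
  define r where "r = block_radius (M, 0, \<theta>, Sp, Sm)"
  define k where "k = (1 - 2 * Sp) / 3"
  define a where "a = (1 + Sp + sqrt 3 * Sm) / 3 - k"
  define b where "b = Sp * sin \<theta> / 3"
  define e where "e = (1 + Sp - sqrt 3 * Sm) / 3 - k"
  have r: "r\<^sup>2 = 3 * Sm\<^sup>2 + (Sp * sin \<theta>)\<^sup>2" "r \<ge> 0"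
    by (simp_all add: r_def block_radius_def)
  \<comment> \<open>The determinant of the shifted block. The mean of \<open>a\<close> and
    \<open>e\<close> is \<open>Sp\<close>, and the assumption amounts to
    \<open>Sp > r / 3\<close>.\<close>
  have "a * e - b\<^sup>2 = Sp\<^sup>2 - (3 * Sm\<^sup>2 + (Sp * sin \<theta>)\<^sup>2) / 9"
  proof -
    have "sqrt 3 * (sqrt 3 * z) = 3 * z" for z
      by (simp flip: mult.assoc)
    then show ?thesis
      by (simp add: a_def b_def e_def k_def field_simps power2_eq_square)
  qed
  also have "\<dots> = (Sp - r / 3) * (Sp + r / 3)"
    unfolding r(1)[symmetric] by (simp add: field_simps power2_eq_square)
  also have "\<dots> > 0"
    using assms r(2) unfolding r_def[symmetric] by (intro mult_pos_pos) auto
  finally have det: "a * e - b\<^sup>2 > 0" .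
  have ker: "y = 0 \<and> z = 0" if "a * y + b * z = 0" "b * y + e * z = 0" for y z
  proof -
    have "(a * e - b\<^sup>2) * y = 0" "(a * e - b\<^sup>2) * z = 0"
      using that by algebra+
    with det show ?thesis
      by simp
  qed
  have W: "weingarten (M, 0, \<theta>, Sp, Sm) =
      vector [vector [k, 0, 0], vector [0, a + k, b], vector [0, b, e + k]]"
    by (simp add: weingarten_OT a_def b_def e_def k_def)
  have "v \<in> eigenspace (weingarten (M, 0, \<theta>, Sp, Sm)) k \<longleftrightarrow> v \<in> span {axis 1 1}" for v
  proof -
    have "v \<in> eigenspace (weingarten (M, 0, \<theta>, Sp, Sm)) k \<longleftrightarrow>
        a * v $ 2 + b * v $ 3 = 0 \<and> b * v $ 2 + e * v $ 3 = 0"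
      unfolding eigenspace_def W
      by (simp add: vec_eq_iff forall_3 matrix_vector_mult_def sum_3) (auto simp: algebra_simps)
    also have "\<dots> \<longleftrightarrow> v $ 2 = 0 \<and> v $ 3 = 0"
      using ker[of "v $ 2" "v $ 3"] by auto
    also have "\<dots> \<longleftrightarrow> v \<in> span {axis 1 1}"
      by (auto simp: span_singleton vec_eq_iff forall_3 axis_def)
    finally show ?thesis .
  qed
  then show ?thesis
    unfolding k_def by blast
qed

text \<open>By \<open>pos\<close> both block eigenvalues have positive limits \<open>b0\<close> and
  \<open>c0\<close>. A non-positive limit can therefore only be that of the smallest eigenvalue,
  with \<open>a0 < b0\<close>; then \<open>a t < b t\<close> eventually, and the smallest eigenvalue
  is simple with eigenvector \<open>axis 1 1\<close>.\<close>

lemma weingarten_eigenvalues_OT: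
  fixes X :: "real \<Rightarrow> state"
  assumes X: "\<And>t. X t = (M t, 0, \<theta> t, p t, s t)"
    and lim: "(\<theta> \<longlongrightarrow> \<psi>) F" "(p \<longlongrightarrow> p0) F" "(s \<longlongrightarrow> s0) F"
    and \<psi>: "sin \<psi> = 0" and pos: "1 + p0 > sqrt 3 * \<bar>s0\<bar>"
  shows "\<exists>(k :: nat \<Rightarrow> real \<Rightarrow> real) (l :: nat \<Rightarrow> real).
    (\<forall>\<tau>. ordered_eigenvalues (weingarten (X \<tau>)) (k 1 \<tau>) (k 2 \<tau>) (k 3 \<tau>)) \<and>
    (\<forall>i\<in>{1, 2, 3}. (k i \<longlongrightarrow> l i) F \<and> (l i \<le> 0 \<longrightarrow>
      (\<forall>\<^sub>F \<tau> in F. eigenspace (weingarten (X \<tau>)) (k i \<tau>) = span {axis 1 1})))"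
proof -
  define a where "a = (\<lambda>t. (1 - 2 * p t) / 3)"
  define b where "b = (\<lambda>t. (1 + p t - block_radius (X t)) / 3)"
  define c where "c = (\<lambda>t. (1 + p t + block_radius (X t)) / 3)"
  define a0 where "a0 = (1 - 2 * p0) / 3"
  define b0 where "b0 = (1 + p0 - sqrt 3 * \<bar>s0\<bar>) / 3"
  define c0 where "c0 = (1 + p0 + sqrt 3 * \<bar>s0\<bar>) / 3"
  define k where "k = (\<lambda>i::nat. if i = 1 then (\<lambda>t. min (a t) (b t))
    else if i = 2 then (\<lambda>t. max (b t) (min (a t) (c t))) else (\<lambda>t. max (a t) (c t)))"
  define l where "l = (\<lambda>i::nat. if i = 1 then min a0 b0
    else if i = 2 then max b0 (min a0 c0) else max a0 c0)"
  have R: "((\<lambda>t. block_radius (X t)) \<longlongrightarrow> sqrt 3 * \<bar>s0\<bar>) F"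
    unfolding X block_radius_def
    by (auto intro!: tendsto_eq_intros lim simp: \<psi> real_sqrt_mult)
  have a_lim: "(a \<longlongrightarrow> a0) F" and b_lim: "(b \<longlongrightarrow> b0) F" and c_lim: "(c \<longlongrightarrow> c0) F"
    unfolding a_def a0_def b_def b0_def c_def c0_def by (auto intro!: tendsto_intros lim R)
  have bc0: "b0 > 0" "c0 > 0"
  proof -
    show "b0 > 0"
      using pos by (simp add: b0_def)
    also have "b0 \<le> c0"
      by (simp add: b0_def c0_def)
    finally show "c0 > 0" .
  qed
  have bc: "b t \<le> c t" for t
    by (simp add: b_def c_def X block_radius_def)
  have "ordered_eigenvalues (weingarten (X t)) (k 1 t) (k 2 t) (k 3 t)" for t
    using ordered_eigenvalues_sort[OF _ bc, of "weingarten (X t)" "a t" t]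
    by (simp add: k_def a_def b_def c_def X det_weingarten_OT)
  moreover have "(k i \<longlongrightarrow> l i) F" for i
    unfolding k_def l_def by (auto intro!: tendsto_min tendsto_max a_lim b_lim c_lim)
  moreover have "\<forall>\<^sub>F t in F. eigenspace (weingarten (X t)) (k i t) = span {axis 1 1}"
    if "i \<in> {1, 2, 3}" "l i \<le> 0" for i
  proof -
    have i: "i = 1" and "a0 < b0"
      using that bc0 by (auto simp: l_def split: if_splits)
    then have "((\<lambda>t. b t - a t) \<longlongrightarrow> b0 - a0) F" "0 < b0 - a0"
      by (auto intro!: tendsto_intros a_lim b_lim)
    then have "\<forall>\<^sub>F t in F. 0 < b t - a t"
      by (rule order_tendstoD)
    then show ?thesis
    proof eventually_elim
      case (elim t)
      then have k: "k i t = (1 - 2 * p t) / 3"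
        by (simp add: k_def i a_def)
      show ?case
        unfolding k X
        by (rule eigenspace_weingarten_OT) (use elim in \<open>simp add: a_def b_def X\<close>)
    qed
  qed
  ultimately show ?thesis
    by blast
qed

section \<open>Reduction of the flow to the locale and conclusion\<close>

theorem proposition4p6:
  fixes \<phi> :: "real \<Rightarrow> state \<Rightarrow> state" and x :: state
  assumes flow: "is_flow \<phi>"
    and x: "x \<in> AD_plus_Omega \<phi> \<inter> OT_plus_Omega"
  shows "(\<exists>p \<in> M23_minus \<union> M32_plus. ((\<lambda>\<tau>. \<phi> \<tau> x) \<longlongrightarrow> p) at_bot) \<and>
    (\<exists>(k :: nat \<Rightarrow> real \<Rightarrow> real) (l :: nat \<Rightarrow> real).
       (\<forall>\<tau>. ordered_eigenvalues (weingarten (\<phi> \<tau> x)) (k 1 \<tau>) (k 2 \<tau>) (k 3 \<tau>)) \<and>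
       (\<forall>i\<in>{1, 2, 3}. (k i \<longlongrightarrow> l i) at_bot \<and>
          (l i \<le> 0 \<longrightarrow>
             (\<forall>\<^sub>F \<tau> in at_bot.
                eigenspace (weingarten (\<phi> \<tau> x)) (k i \<tau>) = span {axis 1 1}))))"
proof -
  define M where "M = (\<lambda>t. fst (\<phi> t x))"
  define P where "P = (\<lambda>t. fst (snd (\<phi> t x)))"
  define \<theta> where "\<theta> = (\<lambda>t. fst (snd (snd (\<phi> t x))))"
  define p where "p = (\<lambda>t. fst (snd (snd (snd (\<phi> t x)))))"
  define s where "s = (\<lambda>t. snd (snd (snd (snd (\<phi> t x)))))"
  define d where "d = (\<lambda>t. 2 * (1 + (sin (\<theta> t))\<^sup>2 / 3) * (M t)\<^sup>2)"
  have X: "\<phi> t x = (M t, P t, \<theta> t, p t, s t)" for t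
    by (simp add: M_def P_def \<theta>_def p_def s_def)
  have xB: "x \<in> B_plus"
    using x by (auto simp: OT_plus_Omega_def B_plus_Omega_def)
  then have x_eq: "x = (M 0, P 0, \<theta> 0, p 0, s 0)"
    using flow X[of 0] by (auto simp: is_flow_def)
  have init: "M 0 > 0" "P 0 = 0" "0 < \<theta> 0" "\<theta> 0 < pi" "Omega (M 0, P 0, \<theta> 0, p 0, s 0) > 0"
    using x unfolding x_eq by (auto simp: OT_plus_Omega_def B_plus_Omega_def B_plus_def)
  have "((\<lambda>t. \<phi> t x) has_vector_derivative vector_field (M t, P t, \<theta> t, p t, s t)) (at t)" for t
    using flow xB by (simp add: is_flow_def flip: X)
  \<comment> \<open>Coordinate projections are bounded linear, so each of them turns the vector
    equation into a scalar one.\<close>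
  then have deriv: "((\<lambda>t. f (\<phi> t x)) has_real_derivative f (vector_field (M t, P t, \<theta> t, p t, s t))) (at t)"
    if "bounded_linear f" for f and t
    unfolding has_real_derivative_iff_has_vector_derivative
    using bounded_linear.has_vector_derivative[OF that] by blast
  note bl = bounded_linear_fst_comp bounded_linear_snd_comp bounded_linear_fst bounded_linear_snd
  have decel: "decel (M t) (\<theta> t) = 2 - d t" for t
    by (simp add: decel_def d_def)
  have P': "(P has_real_derivative
      (- d t - (3 + (sin (\<theta> t))\<^sup>2) * p t + sqrt 3 * cos (\<theta> t) * s t) * P t) (at t)" for t
    using deriv[of "\<lambda>y. fst (snd y)" t] by (simp add: P_def[symmetric] bl Let_def decel)
  have M': "(M has_real_derivative
      (2 - d t + 2 * p t + 2 * sqrt 3 * cos (\<theta> t) * s t) * M t) (at t)" for t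
    using deriv[of fst t] by (simp add: M_def[symmetric] bl Let_def decel)
  have \<theta>': "(\<theta> has_real_derivative - 2 * sqrt 3 * s t * sin (\<theta> t)) (at t)" for t
    using deriv[of "\<lambda>y. fst (snd (snd y))" t] by (simp add: \<theta>_def[symmetric] bl Let_def)
  have p'_P: "(p has_real_derivative - d t * p t - 2 * (M t)\<^sup>2 + 3 * (P t)\<^sup>2) (at t)" for t
    using deriv[of "\<lambda>y. fst (snd (snd (snd y)))" t]
    by (simp add: p_def[symmetric] bl Let_def decel)
  have s'_P: "(s has_real_derivative - d t * s t - sqrt 3 * cos (\<theta> t) *
      (2 * (M t)\<^sup>2 + (P t)\<^sup>2 - 2 / 3 * (sin (\<theta> t))\<^sup>2 * (p t)\<^sup>2)) (at t)" for t
    using deriv[of "\<lambda>y. snd (snd (snd (snd y)))" t]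
    by (simp add: s_def[symmetric] bl Let_def decel)
  have cont: "isCont M t" "isCont \<theta> t" "isCont p t" "isCont s t" for t
    using M' \<theta>' p'_P s'_P by (blast intro: DERIV_isCont)+
  have P0: "P t = 0" for t
  proof -
    have "isCont (\<lambda>t. - d t - (3 + (sin (\<theta> t))\<^sup>2) * p t + sqrt 3 * cos (\<theta> t) * s t) t" for t
      unfolding d_def by (intro continuous_intros cont) auto
    from linear_ode_solution[OF P' this] show ?thesis
      using init(2) by (metis mult_zero_left)
  qed
  note p' = p'_P[unfolded P0, simplified] and s' = s'_P[unfolded P0, simplified]
  have u': "((\<lambda>t. sin (\<theta> t)) has_real_derivative
      (- 2 * sqrt 3 * s t * cos (\<theta> t)) * sin (\<theta> t)) (at t)" for t
    by (auto intro!: derivative_eq_intros \<theta>')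
  have c': "((\<lambda>t. cos (\<theta> t)) has_real_derivative 2 * sqrt 3 * s t * (sin (\<theta> t))\<^sup>2) (at t)" for t
    by (auto intro!: derivative_eq_intros \<theta>' simp: power2_eq_square)
  have u_init: "sin (\<theta> 0) > 0"
    using init(3,4) by (rule sin_gt_zero)
  have u_pos: "sin (\<theta> t) > 0" for t
    by (rule linear_ode_pos[OF u' _ u_init]) (intro continuous_intros cont)
  \<comment> \<open>The range of \<theta> is an interval that meets (0, \<pi>) and avoids both
    endpoints, because the sine stays positive along the orbit.\<close>
  have \<theta>_range: "0 < \<theta> t \<and> \<theta> t < pi" for t
  proof -
    have "connected (range \<theta>)"
      by (intro connected_continuous_image continuous_at_imp_continuous_on) (auto intro: cont)
    then have "z \<in> range \<theta>" if "z \<in> closed_segment (\<theta> 0) (\<theta> t)" for z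
      using that by (auto simp: connected_iff_interval closed_segment_eq_real_ivl split: if_splits)
    moreover have "0 \<notin> range \<theta>" "pi \<notin> range \<theta>"
      using u_pos by (metis imageE less_irrefl sin_zero, metis imageE less_irrefl sin_pi)
    ultimately show ?thesis
      using init(3,4) by (fastforce simp: closed_segment_eq_real_ivl)
  qed
  obtain \<psi> p0 s0 where lim: "((\<lambda>t. \<phi> t x) \<longlongrightarrow> (0, 0, \<psi>, p0, s0)) at_bot"
    and \<psi>: "sin \<psi> = 0" and nonzero: "(p0, s0) \<noteq> (0, 0)"
    using x by (auto simp: AD_plus_Omega_def)
  have M_lim: "(M \<longlongrightarrow> 0) at_bot" and \<theta>_lim: "(\<theta> \<longlongrightarrow> \<psi>) at_bot"
    and p_lim: "(p \<longlongrightarrow> p0) at_bot" and s_lim: "(s \<longlongrightarrow> s0) at_bot"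
    using tendsto_fst[OF lim] tendsto_fst[OF tendsto_snd[OF tendsto_snd[OF lim]]]
      tendsto_fst[OF tendsto_snd[OF tendsto_snd[OF tendsto_snd[OF lim]]]]
      tendsto_snd[OF tendsto_snd[OF tendsto_snd[OF tendsto_snd[OF lim]]]]
    by (simp_all add: M_def \<theta>_def p_def s_def)
  have u_lim: "((\<lambda>t. sin (\<theta> t)) \<longlongrightarrow> 0) at_bot"
    using tendsto_sin[OF \<theta>_lim] \<psi> by simp
  have c_lim: "((\<lambda>t. cos (\<theta> t)) \<longlongrightarrow> cos \<psi>) at_bot"
    by (rule tendsto_cos[OF \<theta>_lim])
  have "0 \<le> \<psi>"
    by (rule tendsto_lowerbound[OF \<theta>_lim]) (use \<theta>_range in \<open>auto simp: less_imp_le\<close>)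
  moreover have "\<psi> \<le> pi"
    by (rule tendsto_upperbound[OF \<theta>_lim]) (use \<theta>_range in \<open>auto simp: less_imp_le\<close>)
  ultimately have "\<psi> = 0 \<or> \<psi> = pi"
    using \<psi> sin_gt_zero[of \<psi>] by force
  \<comment> \<open>The sign of \<open>s0\<close> in each limit set turns its linear inequality into
    the common bound with the absolute value of \<open>s0\<close>.\<close>
  then have "(0, 0, \<psi>, p0, s0) \<in> M23_minus \<union> M32_plus \<and> 1 + p0 > sqrt 3 * \<bar>s0\<bar>"
  proof
    assume "\<psi> = 0"
    interpret ot_solution M "\<lambda>t. sin (\<theta> t)" "\<lambda>t. cos (\<theta> t)" p s d p0 s0
      by standard (use init u_init M' u' c' p' s' M_lim u_lim c_lim p_lim s_lim nonzero \<open>\<psi> = 0\<close>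
          in \<open>auto simp: d_def\<close>)
    show ?thesis
      using limit_location \<open>\<psi> = 0\<close> by (auto simp: M32_plus_def)
  next
    assume "\<psi> = pi"
    \<comment> \<open>The reflected solution: the equations of \<open>M\<close>,
      \<open>sin \<theta>\<close> and \<open>p\<close> contain cosine and \<open>s\<close> only
      through their product and are unchanged.\<close>
    have "((\<lambda>t. - cos (\<theta> t)) has_real_derivative
        2 * sqrt 3 * - s t * (sin (\<theta> t))\<^sup>2) (at t)" for t
      by (rule DERIV_cong[OF DERIV_minus[OF c']]) simp
    moreover have "((\<lambda>t. - s t) has_real_derivative - d t * - s t - sqrt 3 * - cos (\<theta> t) *
        (2 * (M t)\<^sup>2 - 2 / 3 * (sin (\<theta> t))\<^sup>2 * (p t)\<^sup>2)) (at t)" for t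
      by (rule DERIV_cong[OF DERIV_minus[OF s']]) simp
    ultimately interpret ot_solution M "\<lambda>t. sin (\<theta> t)" "\<lambda>t. - cos (\<theta> t)" p "\<lambda>t. - s t" d p0 "- s0"
      by unfold_locales (use init u_init M' u' p' M_lim u_lim
          tendsto_minus[OF c_lim] p_lim tendsto_minus[OF s_lim] nonzero \<open>\<psi> = pi\<close>
          in \<open>auto simp: d_def\<close>)
    show ?thesis
      using limit_location \<open>\<psi> = pi\<close> by (auto simp: M23_minus_def)
  qed
  moreover have "\<phi> t x = (M t, 0, \<theta> t, p t, s t)" for t
    by (simp add: X P0)
  ultimately show ?thesis
    using lim weingarten_eigenvalues_OT[of "\<lambda>t. \<phi> t x", OF _ \<theta>_lim p_lim s_lim \<psi>] by blast
qed

end
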